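(* Let $M$ be an $MV$-algebra. Then $M$ is epicomplete if and only if every epimorphism (in the category of $MV$-algebras) from $M$ into a linearly ordered $MV$-algebra is onto.
   Context: An $MV$-algebra $(M;\oplus,',0,1)$ is meant in the usual sense: $(M;\oplus,0)$ is a commutative monoid, $1=0'$, $x''=x$, $x\oplus 1=1$, and $x\oplus(x\oplus y')'=y\oplus(y\oplus x')'$. It is partially (lattice) ordered by $x\le y\iff x'\oplus y=1$. $\mathcal{MV}$ is the category of $MV$-algebras and $MV$-homomorphisms. An epimorphism is a categorical epimorphism in $\mathcal{MV}$: an $MV$-homomorphism $f:M_1\to M_2$ such that for every $MV$-algebra $M_3$ and all $MV$-homomorphisms $\alpha,\beta:M_2\to M_3$, $\alpha\circ f=\beta\circ f$ implies $\alpha=\beta$. An $MV$-algebra $M$ is epicomplete if every epimorphism $\alpha:M\to A$ in $\mathcal{MV}$ (for every $MV$-algebra $A$) is surjective. *)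

theory Defs
  imports "HOL-Algebra.Group"
begin

record 'a mv_algebra = "'a partial_object" +
  mv_plus :: "'a \<Rightarrow> 'a \<Rightarrow> 'a"
  mv_neg :: "'a \<Rightarrow> 'a"
  mv_zero :: 'a
  mv_one :: 'a

locale mv_algebra =
  fixes M :: "'a mv_algebra"
  assumes comm_monoid: "comm_monoid \<lparr>carrier = carrier M, mult = mv_plus M, one = mv_zero M\<rparr>"
    and neg_closed: "x \<in> carrier M \<Longrightarrow> mv_neg M x \<in> carrier M"
    and one_eq: "mv_one M = mv_neg M (mv_zero M)"
    and neg_neg: "x \<in> carrier M \<Longrightarrow> mv_neg M (mv_neg M x) = x"
    and plus_one: "x \<in> carrier M \<Longrightarrow> mv_plus M x (mv_one M) = mv_one M"
    and lukasiewicz: "x \<in> carrier M \<Longrightarrow> y \<in> carrier M \<Longrightarrow>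
      mv_plus M x (mv_neg M (mv_plus M x (mv_neg M y))) = mv_plus M y (mv_neg M (mv_plus M y (mv_neg M x)))"

definition mv_le :: "'a mv_algebra \<Rightarrow> 'a \<Rightarrow> 'a \<Rightarrow> bool" where
  "mv_le M x y \<longleftrightarrow> mv_plus M (mv_neg M x) y = mv_one M"

text \<open>The one-element algebra counts as linearly ordered.\<close>

definition linearly_ordered :: "'a mv_algebra \<Rightarrow> bool" where
  "linearly_ordered M \<longleftrightarrow> (\<forall>x\<in>carrier M. \<forall>y\<in>carrier M. mv_le M x y \<or> mv_le M y x)"

definition mv_hom :: "'a mv_algebra \<Rightarrow> 'b mv_algebra \<Rightarrow> ('a \<Rightarrow> 'b) set" where
  "mv_hom M N = {f. f \<in> carrier M \<rightarrow> carrier N \<and>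
     (\<forall>x\<in>carrier M. \<forall>y\<in>carrier M. f (mv_plus M x y) = mv_plus N (f x) (f y)) \<and>
     (\<forall>x\<in>carrier M. f (mv_neg M x) = mv_neg N (f x)) \<and>
     f (mv_zero M) = mv_zero N \<and> f (mv_one M) = mv_one N}"

text \<open>Two homomorphisms are the same morphism if they agree on the carrier.
  A definition cannot quantify over the type of the test algebra \<open>P\<close>. The type
  \<open>'b + nat\<close> is large enough to make the cancellation property hold for test algebras
  of every type, which is lemma \<open>mv_epi_cancel\<close> below.\<close>

definition mv_epi :: "'a mv_algebra \<Rightarrow> 'b mv_algebra \<Rightarrow> ('a \<Rightarrow> 'b) \<Rightarrow> bool" where
  "mv_epi M N f \<longleftrightarrow> f \<in> mv_hom M N \<and>
     (\<forall>(P :: ('b + nat) mv_algebra) \<alpha> \<beta>.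
        mv_algebra P \<longrightarrow> \<alpha> \<in> mv_hom N P \<longrightarrow> \<beta> \<in> mv_hom N P \<longrightarrow>
        (\<forall>x\<in>carrier M. \<alpha> (f x) = \<beta> (f x)) \<longrightarrow> (\<forall>y\<in>carrier N. \<alpha> y = \<beta> y))"

text \<open>The codomains \<open>A\<close> range over the algebras with carrier in an arbitrary type \<open>'u\<close>, which is
  passed as a parameter. By \<open>epicomplete_mono\<close> below, the notion becomes stronger
  as \<open>'u\<close> grows. Epicompleteness of \<open>M\<close> is \<open>epicomplete TYPE('u) M\<close> for all \<open>'u\<close>.\<close>

definition epicomplete :: "'u itself \<Rightarrow> 'a mv_algebra \<Rightarrow> bool" where
  "epicomplete _ M \<longleftrightarrow>
     (\<forall>(A :: 'u mv_algebra) f. mv_algebra A \<longrightarrow> mv_epi M A f \<longrightarrow> f ` carrier M = carrier A)"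


context mv_algebra
begin

lemma plus_closed: "x \<in> carrier M \<Longrightarrow> y \<in> carrier M \<Longrightarrow> mv_plus M x y \<in> carrier M"
  using monoid.m_closed[OF comm_monoid.axioms(1)[OF comm_monoid]] by simp

lemma zero_closed: "mv_zero M \<in> carrier M"
  using monoid.one_closed[OF comm_monoid.axioms(1)[OF comm_monoid]] by simp

lemma one_closed: "mv_one M \<in> carrier M"
  by (simp add: one_eq neg_closed zero_closed)

lemma plus_assoc: "x \<in> carrier M \<Longrightarrow> y \<in> carrier M \<Longrightarrow> z \<in> carrier M \<Longrightarrow>
    mv_plus M (mv_plus M x y) z = mv_plus M x (mv_plus M y z)"
  using monoid.m_assoc[OF comm_monoid.axioms(1)[OF comm_monoid]] by simp

lemma plus_comm: "x \<in> carrier M \<Longrightarrow> y \<in> carrier M \<Longrightarrow> mv_plus M x y = mv_plus M y x"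
  using comm_monoid.m_comm[OF comm_monoid] by simp

lemma zero_plus: "x \<in> carrier M \<Longrightarrow> mv_plus M (mv_zero M) x = x"
  using monoid.l_one[OF comm_monoid.axioms(1)[OF comm_monoid]] by simp

lemma plus_lcomm: "x \<in> carrier M \<Longrightarrow> y \<in> carrier M \<Longrightarrow> z \<in> carrier M \<Longrightarrow>
    mv_plus M x (mv_plus M y z) = mv_plus M y (mv_plus M x z)"
  by (metis plus_assoc plus_comm)

lemma plus_zero: "x \<in> carrier M \<Longrightarrow> mv_plus M x (mv_zero M) = x"
  by (metis plus_comm zero_closed zero_plus)

end

lemma mv_algebraI:
  assumes "\<And>x y. x \<in> carrier M \<Longrightarrow> y \<in> carrier M \<Longrightarrow> mv_plus M x y \<in> carrier M"
    and "mv_zero M \<in> carrier M"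
    and "\<And>x y z. x \<in> carrier M \<Longrightarrow> y \<in> carrier M \<Longrightarrow> z \<in> carrier M \<Longrightarrow>
      mv_plus M (mv_plus M x y) z = mv_plus M x (mv_plus M y z)"
    and "\<And>x y. x \<in> carrier M \<Longrightarrow> y \<in> carrier M \<Longrightarrow> mv_plus M x y = mv_plus M y x"
    and "\<And>x. x \<in> carrier M \<Longrightarrow> mv_plus M (mv_zero M) x = x"
    and "\<And>x. x \<in> carrier M \<Longrightarrow> mv_neg M x \<in> carrier M"
    and "mv_one M = mv_neg M (mv_zero M)"
    and "\<And>x. x \<in> carrier M \<Longrightarrow> mv_neg M (mv_neg M x) = x"
    and "\<And>x. x \<in> carrier M \<Longrightarrow> mv_plus M x (mv_one M) = mv_one M"
    and "\<And>x y. x \<in> carrier M \<Longrightarrow> y \<in> carrier M \<Longrightarrow>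
      mv_plus M x (mv_neg M (mv_plus M x (mv_neg M y))) = mv_plus M y (mv_neg M (mv_plus M y (mv_neg M x)))"
  shows "mv_algebra M"
  by (rule mv_algebra.intro, rule comm_monoidI) (simp_all, (fact assms)+)

definition mv_transport :: "('a \<Rightarrow> 'b) \<Rightarrow> 'a mv_algebra \<Rightarrow> 'b mv_algebra" where
  "mv_transport g M = (let h = inv_into (carrier M) g in
     \<lparr>carrier = g ` carrier M, mv_plus = (\<lambda>x y. g (mv_plus M (h x) (h y))),
      mv_neg = (\<lambda>x. g (mv_neg M (h x))), mv_zero = g (mv_zero M), mv_one = g (mv_one M)\<rparr>)"

lemma mv_transport:
  assumes M: "mv_algebra M" and g: "inj_on g (carrier M)"
  shows "mv_algebra (mv_transport g M)" "g \<in> mv_hom M (mv_transport g M)"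
proof -
  interpret mv_algebra M by (fact M)
  note [simp] = plus_closed zero_closed one_closed neg_closed neg_neg plus_one zero_plus
    plus_zero inv_into_f_f[OF g]
  show "mv_algebra (mv_transport g M)"
    by (rule mv_algebraI)
      (auto simp: mv_transport_def Let_def plus_assoc plus_comm plus_lcomm lukasiewicz one_eq[symmetric])
  show "g \<in> mv_hom M (mv_transport g M)"
    by (auto simp: mv_transport_def Let_def mv_hom_def)
qed

lemma mv_hom_comp:
  assumes "f \<in> mv_hom M N" "g \<in> mv_hom N P"
  shows "(\<lambda>x. g (f x)) \<in> mv_hom M P"
  using assms by (fastforce simp: mv_hom_def Pi_iff)

lemma mv_subalgebra:
  assumes P: "mv_algebra P" and S: "S \<subseteq> carrier P" "mv_zero P \<in> S" "\<And>x. x \<in> S \<Longrightarrow> mv_neg P x \<in> S"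
    "\<And>x y. x \<in> S \<Longrightarrow> y \<in> S \<Longrightarrow> mv_plus P x y \<in> S"
  shows "mv_algebra (P\<lparr>carrier := S\<rparr>)"
proof -
  interpret mv_algebra P by (fact P)
  have [simp]: "x \<in> carrier P" if "x \<in> S" for x using S(1) that by blast
  show ?thesis
    by (rule mv_algebraI)
      (simp_all add: S neg_neg plus_one zero_plus plus_zero plus_assoc plus_comm plus_lcomm
        lukasiewicz one_eq[symmetric])
qed

text \<open>Two homomorphisms out of \<open>N\<close> have images in a common subalgebra that embeds
  into \<open>'b + nat\<close>.\<close>

lemma mv_small_subalgebra:
  includes cardinal_syntax
  fixes N :: "'b mv_algebra" and P :: "'c mv_algebra"
  assumes P: "mv_algebra P" and \<alpha>: "\<alpha> \<in> mv_hom N P" and \<beta>: "\<beta> \<in> mv_hom N P"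
  obtains S and g :: "'c \<Rightarrow> 'b + nat" where
    "mv_algebra (P\<lparr>carrier := S\<rparr>)" "inj_on g S"
    "\<alpha> \<in> mv_hom N (P\<lparr>carrier := S\<rparr>)" "\<beta> \<in> mv_hom N (P\<lparr>carrier := S\<rparr>)"
proof -
  interpret mv_algebra P by (fact P)
  let ?U = "UNIV :: ('b + nat) set"
  define step where "step X = X \<union> (mv_neg P ` X \<union> case_prod (mv_plus P) ` (X \<times> X))" for X
  define L where "L n = (step ^^ n) (insert (mv_zero P) (\<alpha> ` carrier N \<union> \<beta> ` carrier N))" for n
  define S where "S = (\<Union>n. L n)"
  have L0: "L 0 = insert (mv_zero P) (\<alpha> ` carrier N \<union> \<beta> ` carrier N)" by (simp add: L_def)
  have LS: "L (Suc n) = step (L n)" for n by (simp add: L_def)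
  have mono: "L m \<subseteq> L n" if "m \<le> n" for m n
    by (rule lift_Suc_mono_le[OF _ that]) (auto simp: LS step_def)
  have inf: "infinite ?U"
    using finite_imageD[of "Inr :: nat \<Rightarrow> 'b + nat" UNIV] finite_subset subset_UNIV by fastforce
  then have inf': "infinite (Field |?U| )" by (simp only: Field_card_of not_False_eq_True)
  have union: "|X \<union> Y| \<le>o |?U|" if "|X| \<le>o |?U|" "|Y| \<le>o |?U|" for X Y :: "'c set"
    by (rule card_of_Un_ordLeq_infinite_Field[OF inf' that card_of_Card_order])
  have image: "|h ` X| \<le>o |?U|" if "|X| \<le>o |?U|" for h :: "'x \<Rightarrow> 'c" and X :: "'x set"
    using card_of_image ordLeq_transitive that by blast
  have carrierN: "|carrier N| \<le>o |?U|"
    by (intro card_of_ordLeqI[of Inl]) auto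
  have card_L: "|L n| \<le>o |?U|" for n
  proof (induction n)
    case 0
    have "|{mv_zero P}| \<le>o |?U|" using inf by (intro card_of_ordLeqI[of "\<lambda>_. undefined"]) auto
    then show ?case
      using union[OF _ union[OF image[OF carrierN] image[OF carrierN]], of "{mv_zero P}" \<alpha> \<beta>]
      by (simp add: L0)
  next
    case (Suc n)
    have "|L n \<times> L n| \<le>o |?U|"
      by (rule card_of_Times_ordLeq_infinite_Field[OF inf' Suc Suc card_of_Card_order])
    then show ?case
      unfolding LS step_def by (intro union image Suc)
  qed
  have "|UNIV :: nat set| \<le>o |?U|" by (intro card_of_ordLeqI[of Inr]) auto
  then have "|S| \<le>o |?U|"
    unfolding S_def using card_of_UNION_ordLeq_infinite[OF inf] card_L by blast
  then obtain g :: "'c \<Rightarrow> 'b + nat" where g: "inj_on g S"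
    by (auto simp: card_of_ordLeq[symmetric])
  have "L n \<subseteq> carrier P" for n
  proof (induction n)
    case 0
    show ?case using \<alpha> \<beta> zero_closed by (auto simp: L0 mv_hom_def)
  qed (auto simp: LS step_def neg_closed plus_closed subset_iff)
  then have S: "S \<subseteq> carrier P" by (auto simp: S_def)
  have sub: "mv_algebra (P\<lparr>carrier := S\<rparr>)"
  proof (rule mv_subalgebra[OF P S])
    show "mv_zero P \<in> S" unfolding S_def using L0 by blast
    show "mv_neg P x \<in> S" if "x \<in> S" for x
    proof -
      obtain n where "x \<in> L n" using \<open>x \<in> S\<close> by (auto simp: S_def)
      then have "mv_neg P x \<in> L (Suc n)" by (auto simp: LS step_def)
      then show ?thesis unfolding S_def by blast
    qed
    show "mv_plus P x y \<in> S" if xy: "x \<in> S" "y \<in> S" for x y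
    proof -
      obtain m n where "x \<in> L m" "y \<in> L n" using xy by (auto simp: S_def)
      then have "x \<in> L (max m n)" "y \<in> L (max m n)"
        using mono[of m "max m n"] mono[of n "max m n"] by auto
      then have "mv_plus P x y \<in> L (Suc (max m n))" by (force simp: LS step_def)
      then show ?thesis unfolding S_def by blast
    qed
  qed
  have "L 0 \<subseteq> S" unfolding S_def by blast
  then have "\<alpha> ` carrier N \<subseteq> S" "\<beta> ` carrier N \<subseteq> S" unfolding L0 by auto
  then have "\<alpha> \<in> mv_hom N (P\<lparr>carrier := S\<rparr>)" "\<beta> \<in> mv_hom N (P\<lparr>carrier := S\<rparr>)"
    using \<alpha> \<beta> by (auto simp: mv_hom_def)
  then show thesis using that sub g by blast
qed

lemma mv_epi_cancel:
  fixes M :: "'a mv_algebra" and N :: "'b mv_algebra" and P :: "'c mv_algebra"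
  assumes f: "mv_epi M N f" and P: "mv_algebra P" and \<alpha>: "\<alpha> \<in> mv_hom N P" and \<beta>: "\<beta> \<in> mv_hom N P"
    and eq: "\<And>x. x \<in> carrier M \<Longrightarrow> \<alpha> (f x) = \<beta> (f x)" and y: "y \<in> carrier N"
  shows "\<alpha> y = \<beta> y"
proof -
  obtain S and g :: "'c \<Rightarrow> 'b + nat" where S: "mv_algebra (P\<lparr>carrier := S\<rparr>)"
    and g: "inj_on g (carrier (P\<lparr>carrier := S\<rparr>))"
    and \<alpha>S: "\<alpha> \<in> mv_hom N (P\<lparr>carrier := S\<rparr>)" and \<beta>S: "\<beta> \<in> mv_hom N (P\<lparr>carrier := S\<rparr>)"
    using mv_small_subalgebra[OF P \<alpha> \<beta>] by (metis partial_object.simps(1) partial_object.surjective partial_object.update_convs(1))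
  note T = mv_transport[OF S g]
  have "g (\<alpha> y) = g (\<beta> y)"
    using f[unfolded mv_epi_def, THEN conjunct2, rule_format,
        OF T(1) mv_hom_comp[OF \<alpha>S T(2)] mv_hom_comp[OF \<beta>S T(2)]] eq y by simp
  moreover have "\<alpha> y \<in> carrier (P\<lparr>carrier := S\<rparr>)" "\<beta> y \<in> carrier (P\<lparr>carrier := S\<rparr>)"
    using \<alpha>S \<beta>S y by (auto simp: mv_hom_def)
  ultimately show ?thesis using g by (meson inj_onD)
qed

lemma epicomplete_mono:
  fixes g :: "'u \<Rightarrow> 'v"
  assumes g: "inj g" and M: "epicomplete TYPE('v) M"
  shows "epicomplete TYPE('u) M"
  unfolding epicomplete_def
proof (intro allI impI)
  fix A :: "'u mv_algebra" and f
  assume A: "mv_algebra A" and f: "mv_epi M A f"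
  have gA: "inj_on g (carrier A)" using g by (rule inj_on_subset) simp
  note T = mv_transport[OF A gA]
  have "mv_epi M (mv_transport g A) (\<lambda>x. g (f x))"
    unfolding mv_epi_def
  proof (intro conjI allI impI ballI)
    show "(\<lambda>x. g (f x)) \<in> mv_hom M (mv_transport g A)"
      using f T(2) by (auto simp: mv_epi_def intro: mv_hom_comp)
    fix P :: "('v + nat) mv_algebra" and \<alpha> \<beta> y
    assume P: "mv_algebra P" and h: "\<alpha> \<in> mv_hom (mv_transport g A) P" "\<beta> \<in> mv_hom (mv_transport g A) P"
      and eq: "\<forall>x\<in>carrier M. \<alpha> (g (f x)) = \<beta> (g (f x))" and y: "y \<in> carrier (mv_transport g A)"
    obtain a where "a \<in> carrier A" "y = g a" using y by (auto simp: mv_transport_def Let_def)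
    then show "\<alpha> y = \<beta> y"
      using mv_epi_cancel[OF f P mv_hom_comp[OF T(2) h(1)] mv_hom_comp[OF T(2) h(2)]] eq by simp
  qed
  then have "g ` f ` carrier M = carrier (mv_transport g A)"
    using M T(1) by (simp add: epicomplete_def image_image)
  then have "g ` f ` carrier M = g ` carrier A"
    by (simp add: mv_transport_def Let_def)
  then show "f ` carrier M = carrier A"
    using g by (simp add: inj_image_eq_iff)
qed

end

theory Submission
  imports Defs
begin

text \<open>
  Let \<open>f : M \<rightarrow> A\<close> be an epimorphism, and suppose that \<open>M\<close> maps onto \<open>A/P\<close> for each prime ideal
  \<open>P\<close> of \<open>A\<close>. For primes \<open>P\<close>, \<open>Q\<close> of \<open>A\<close> put \<open>J = f\<^sup>-\<^sup>1 P + f\<^sup>-\<^sup>1 Q\<close>. The two maps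
  \<open>A \<rightarrow> A/P \<cong> M/f\<^sup>-\<^sup>1 P \<rightarrow> M/J\<close> and \<open>A \<rightarrow> A/Q \<cong> M/f\<^sup>-\<^sup>1 Q \<rightarrow> M/J\<close> agree on \<open>f M\<close>, hence are
  equal. By a Chinese remainder argument every \<open>a\<close> in \<open>A\<close> has an \<open>m\<close> in \<open>M\<close> with \<open>f m \<le> a\<close> modulo
  \<open>P\<close> and \<open>a \<le> f m\<close> modulo \<open>Q\<close>. As in the proof of the Stone--Weierstrass theorem, joins and
  meets of such \<open>m\<close> yield one with \<open>f m = a\<close>; the compactness argument is replaced by the
  existence of a prime ideal disjoint from a given down-directed set without zero.
\<close>

subsection \<open>Order and truncated difference\<close>

text \<open>On the real unit interval this is \<open>max 0 (x - y)\<close>. Its residuation law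
  \<open>diff_le_iff\<close> drives the order computations below.\<close>

definition mv_diff :: "'a mv_algebra \<Rightarrow> 'a \<Rightarrow> 'a \<Rightarrow> 'a" where
  "mv_diff M x y = mv_neg M (mv_plus M (mv_neg M x) y)"

text \<open>Up to commutativity of addition, the axiom \<open>lukasiewicz\<close> says that this
  expression is symmetric in \<open>x\<close> and \<open>y\<close>.\<close>

definition mv_sup :: "'a mv_algebra \<Rightarrow> 'a \<Rightarrow> 'a \<Rightarrow> 'a" where
  "mv_sup M x y = mv_plus M x (mv_diff M y x)"

definition mv_inf :: "'a mv_algebra \<Rightarrow> 'a \<Rightarrow> 'a \<Rightarrow> 'a" where
  "mv_inf M x y = mv_neg M (mv_sup M (mv_neg M x) (mv_neg M y))"

definition mv_ideal :: "'a mv_algebra \<Rightarrow> 'a set \<Rightarrow> bool" where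
  "mv_ideal M I \<longleftrightarrow> I \<subseteq> carrier M \<and> mv_zero M \<in> I \<and> (\<forall>x\<in>I. \<forall>y\<in>I. mv_plus M x y \<in> I) \<and>
     (\<forall>x\<in>I. \<forall>y\<in>carrier M. mv_le M y x \<longrightarrow> y \<in> I)"

text \<open>The improper ideal counts as prime.\<close>

definition mv_prime :: "'a mv_algebra \<Rightarrow> 'a set \<Rightarrow> bool" where
  "mv_prime M P \<longleftrightarrow> mv_ideal M P \<and>
     (\<forall>x\<in>carrier M. \<forall>y\<in>carrier M. mv_diff M x y \<in> P \<or> mv_diff M y x \<in> P)"

text \<open>Only a bound by a sum is asked for, so downward closure follows from transitivity and
  \<open>z\<close> need not be decomposed into two summands.\<close>

definition ideal_sum :: "'a mv_algebra \<Rightarrow> 'a set \<Rightarrow> 'a set \<Rightarrow> 'a set" where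
  "ideal_sum M I J = {z \<in> carrier M. \<exists>u\<in>I. \<exists>v\<in>J. mv_le M z (mv_plus M u v)}"

text \<open>For \<open>u\<close>, \<open>v\<close> in the carrier this is
  \<open>mv_inf M u v = mv_zero M\<close>; the form with lower bounds combines directly with
  residuation.\<close>

definition disjoint_elts :: "'a mv_algebra \<Rightarrow> 'a \<Rightarrow> 'a \<Rightarrow> bool" where
  "disjoint_elts M u v \<longleftrightarrow> (\<forall>z\<in>carrier M. mv_le M z u \<longrightarrow> mv_le M z v \<longrightarrow> z = mv_zero M)"

definition polar :: "'a mv_algebra \<Rightarrow> 'a set \<Rightarrow> 'a set" where
  "polar M X = {w \<in> carrier M. \<forall>x\<in>X. disjoint_elts M w x}"

definition mv_cong :: "'a mv_algebra \<Rightarrow> 'a set \<Rightarrow> 'a \<Rightarrow> 'a \<Rightarrow> bool" where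
  "mv_cong M I x y \<longleftrightarrow> mv_diff M x y \<in> I \<and> mv_diff M y x \<in> I"

definition mv_rep :: "'a mv_algebra \<Rightarrow> 'a set \<Rightarrow> 'a \<Rightarrow> 'a" where
  "mv_rep M I x = (SOME y. y \<in> carrier M \<and> mv_cong M I x y)"

text \<open>The quotient consists of chosen representatives of the classes, so that it stays in
  the type of \<open>M\<close>.\<close>

definition mv_quotient :: "'a mv_algebra \<Rightarrow> 'a set \<Rightarrow> 'a mv_algebra" where
  "mv_quotient M I = \<lparr>carrier = mv_rep M I ` carrier M,
     mv_plus = (\<lambda>x y. mv_rep M I (mv_plus M x y)), mv_neg = (\<lambda>x. mv_rep M I (mv_neg M x)),
     mv_zero = mv_rep M I (mv_zero M), mv_one = mv_rep M I (mv_one M)\<rparr>"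

lemma mv_idealD:
  assumes "mv_ideal M I"
  shows "x \<in> I \<Longrightarrow> x \<in> carrier M" "mv_zero M \<in> I"
    "x \<in> I \<Longrightarrow> y \<in> I \<Longrightarrow> mv_plus M x y \<in> I"
    "x \<in> I \<Longrightarrow> y \<in> carrier M \<Longrightarrow> mv_le M y x \<Longrightarrow> y \<in> I"
  using assms by (auto simp: mv_ideal_def)

context mv_algebra
begin

abbreviation plus (infixl "\<oplus>" 65) where "x \<oplus> y \<equiv> mv_plus M x y"
abbreviation diff (infixl "\<ominus>" 65) where "x \<ominus> y \<equiv> mv_diff M x y"
abbreviation le (infix "\<preceq>" 50) where "x \<preceq> y \<equiv> mv_le M x y"
abbreviation neg where "neg \<equiv> mv_neg M"
abbreviation zero ("\<^bold>0") where "\<^bold>0 \<equiv> mv_zero M"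
abbreviation one ("\<^bold>1") where "\<^bold>1 \<equiv> mv_one M"

section \<open>Closure rules and the natural order\<close>

lemma diff_closed: "x \<in> carrier M \<Longrightarrow> y \<in> carrier M \<Longrightarrow> x \<ominus> y \<in> carrier M"
  by (simp add: mv_diff_def plus_closed neg_closed)

lemma sup_closed: "x \<in> carrier M \<Longrightarrow> y \<in> carrier M \<Longrightarrow> mv_sup M x y \<in> carrier M"
  by (simp add: mv_sup_def plus_closed diff_closed)

lemma inf_closed: "x \<in> carrier M \<Longrightarrow> y \<in> carrier M \<Longrightarrow> mv_inf M x y \<in> carrier M"
  by (simp add: mv_inf_def sup_closed neg_closed)

lemmas closed [simp] = plus_closed neg_closed zero_closed one_closed diff_closed sup_closed inf_closed

lemmas basic [simp] = neg_neg plus_zero zero_plus plus_one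

lemma neg_zero [simp]: "neg \<^bold>0 = \<^bold>1"
  by (simp add: one_eq[symmetric])

lemma neg_one [simp]: "neg \<^bold>1 = \<^bold>0"
  by (metis neg_neg one_eq zero_closed)

lemma one_plus [simp]: "x \<in> carrier M \<Longrightarrow> \<^bold>1 \<oplus> x = \<^bold>1"
  by (metis plus_comm one_closed plus_one)

lemma neg_plus_self: "x \<in> carrier M \<Longrightarrow> neg x \<oplus> x = \<^bold>1"
  \<comment> \<open>At this instance the left side of the axiom is \<open>x \<oplus> neg x\<close>,
    and the right side is absorbed by one.\<close>
  using lukasiewicz[of x "\<^bold>1"] by (simp add: plus_comm)

lemma le_refl: "x \<in> carrier M \<Longrightarrow> x \<preceq> x"
  by (simp add: mv_le_def neg_plus_self)

lemma le_plus: "x \<in> carrier M \<Longrightarrow> y \<in> carrier M \<Longrightarrow> x \<preceq> x \<oplus> y"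
  by (simp add: mv_le_def neg_plus_self plus_assoc[symmetric])

lemma le_plus2: "x \<in> carrier M \<Longrightarrow> y \<in> carrier M \<Longrightarrow> x \<preceq> y \<oplus> x"
  by (metis le_plus plus_comm)

lemma le_one: "x \<in> carrier M \<Longrightarrow> x \<preceq> \<^bold>1"
  by (simp add: mv_le_def)

lemma zero_le: "x \<in> carrier M \<Longrightarrow> \<^bold>0 \<preceq> x"
  by (simp add: mv_le_def)

lemma sup_comm: "x \<in> carrier M \<Longrightarrow> y \<in> carrier M \<Longrightarrow> mv_sup M x y = mv_sup M y x"
  using lukasiewicz[of x y] by (simp add: mv_sup_def mv_diff_def plus_comm)

text \<open>For \<open>x \<preceq> y\<close> the difference \<open>x \<ominus> y\<close> vanishes,
  so the join written from the other side is just \<open>y\<close>.\<close>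

lemma le_imp_plus_diff:
  assumes "x \<in> carrier M" "y \<in> carrier M" "x \<preceq> y"
  shows "x \<oplus> (y \<ominus> x) = y"
  using sup_comm[OF assms(1,2)] assms by (simp add: mv_sup_def mv_diff_def mv_le_def)

lemma le_antisym:
  assumes "x \<in> carrier M" "y \<in> carrier M" "x \<preceq> y" "y \<preceq> x"
  shows "x = y"
  using sup_comm[OF assms(1,2)] assms by (simp add: mv_sup_def mv_diff_def mv_le_def)

lemma le_trans:
  assumes "x \<in> carrier M" "y \<in> carrier M" "z \<in> carrier M" "x \<preceq> y" "y \<preceq> z"
  shows "x \<preceq> z"
proof -
  \<comment> \<open>\<open>z\<close> is \<open>x\<close> plus the two successive increments, and
    \<open>x\<close> lies below every sum that contains it.\<close>
  have "x \<oplus> ((y \<ominus> x) \<oplus> (z \<ominus> y)) = z"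
    using assms by (simp add: plus_assoc[symmetric] le_imp_plus_diff)
  then show ?thesis
    using le_plus[of x "(y \<ominus> x) \<oplus> (z \<ominus> y)"] assms by simp
qed

lemma plus_mono:
  assumes "x \<in> carrier M" "y \<in> carrier M" "z \<in> carrier M" "y \<preceq> z"
  shows "x \<oplus> y \<preceq> x \<oplus> z"
  using le_plus[of "x \<oplus> y" "z \<ominus> y"] assms by (simp add: plus_assoc le_imp_plus_diff)

lemma plus_mono2:
  assumes "x \<in> carrier M" "y \<in> carrier M" "u \<in> carrier M" "v \<in> carrier M" "x \<preceq> u" "y \<preceq> v"
  shows "x \<oplus> y \<preceq> u \<oplus> v"
proof (rule le_trans)
  show "x \<oplus> y \<preceq> x \<oplus> v" using assms by (simp add: plus_mono)
  show "x \<oplus> v \<preceq> u \<oplus> v" using assms plus_mono[of v x u] by (simp add: plus_comm)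
qed (use assms in simp_all)

lemma neg_le_neg:
  assumes "x \<in> carrier M" "y \<in> carrier M"
  shows "neg x \<preceq> neg y \<longleftrightarrow> y \<preceq> x"
  using assms by (simp add: mv_le_def plus_comm)

text \<open>Unfolded, both sides say that \<open>neg x \<oplus> y \<oplus> z\<close> is one.\<close>

lemma diff_le_iff:
  assumes "x \<in> carrier M" "y \<in> carrier M" "z \<in> carrier M"
  shows "x \<ominus> y \<preceq> z \<longleftrightarrow> x \<preceq> y \<oplus> z"
  using assms by (simp add: mv_le_def mv_diff_def plus_assoc)

lemma diff_eq_zero_iff:
  assumes "x \<in> carrier M" "y \<in> carrier M"
  shows "x \<ominus> y = \<^bold>0 \<longleftrightarrow> x \<preceq> y"
proof
  assume "x \<ominus> y = \<^bold>0"
  then show "x \<preceq> y" using diff_le_iff[of x y "\<^bold>0"] assms by (simp add: le_refl)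
qed (simp add: mv_diff_def mv_le_def)

lemma diff_le: "x \<in> carrier M \<Longrightarrow> y \<in> carrier M \<Longrightarrow> x \<ominus> y \<preceq> x"
  by (simp add: diff_le_iff le_plus2)

lemma le_plus_diff: "x \<in> carrier M \<Longrightarrow> y \<in> carrier M \<Longrightarrow> x \<preceq> y \<oplus> (x \<ominus> y)"
  using diff_le_iff[of x y "x \<ominus> y"] by (simp add: le_refl)

lemma diff_mono:
  assumes "x \<in> carrier M" "y \<in> carrier M" "z \<in> carrier M" "x \<preceq> y"
  shows "x \<ominus> z \<preceq> y \<ominus> z"
  using assms le_trans[OF _ _ _ assms(4) le_plus_diff[of y z]] by (simp add: diff_le_iff)

lemma diff_antimono:
  assumes "x \<in> carrier M" "y \<in> carrier M" "z \<in> carrier M" "x \<preceq> y"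
  shows "z \<ominus> y \<preceq> z \<ominus> x"
proof -
  have "z \<preceq> x \<oplus> (z \<ominus> x)" using assms by (simp add: le_plus_diff)
  moreover have "x \<oplus> (z \<ominus> x) \<preceq> y \<oplus> (z \<ominus> x)" using assms by (simp add: plus_mono2 le_refl)
  ultimately show ?thesis using assms le_trans[of z "x \<oplus> (z \<ominus> x)" "y \<oplus> (z \<ominus> x)"]
    by (simp add: diff_le_iff)
qed

text \<open>This makes congruence modulo an ideal transitive, as \<open>diff_plus_le\<close> makes
  it compatible with addition.\<close>

lemma diff_triangle:
  assumes "x \<in> carrier M" "y \<in> carrier M" "z \<in> carrier M"
  shows "x \<ominus> z \<preceq> (x \<ominus> y) \<oplus> (y \<ominus> z)"
proof -
  have "y \<oplus> (x \<ominus> y) \<preceq> (z \<oplus> (y \<ominus> z)) \<oplus> (x \<ominus> y)"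
    using assms by (simp add: plus_mono2 le_refl le_plus_diff)
  then have "x \<preceq> (z \<oplus> (y \<ominus> z)) \<oplus> (x \<ominus> y)"
    using assms by (intro le_trans[OF _ _ _ le_plus_diff[of x y]]) simp_all
  then show ?thesis
    using assms by (simp add: diff_le_iff plus_assoc plus_comm plus_lcomm)
qed

lemma diff_plus_le:
  assumes "x \<in> carrier M" "y \<in> carrier M" "u \<in> carrier M" "v \<in> carrier M"
  shows "(x \<oplus> u) \<ominus> (y \<oplus> v) \<preceq> (x \<ominus> y) \<oplus> (u \<ominus> v)"
proof -
  have "x \<oplus> u \<preceq> (y \<oplus> (x \<ominus> y)) \<oplus> (v \<oplus> (u \<ominus> v))"
    using assms by (simp add: plus_mono2 le_plus_diff)
  also have "\<dots> = (y \<oplus> v) \<oplus> ((x \<ominus> y) \<oplus> (u \<ominus> v))"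
    using assms by (simp add: plus_assoc plus_lcomm)
  finally show ?thesis using assms by (simp add: diff_le_iff)
qed

lemma neg_diff_neg: "x \<in> carrier M \<Longrightarrow> y \<in> carrier M \<Longrightarrow> neg x \<ominus> neg y = y \<ominus> x"
  by (simp add: mv_diff_def plus_comm)

section \<open>Joins and meets\<close>

lemma sup_upper:
  assumes "x \<in> carrier M" "y \<in> carrier M"
  shows "x \<preceq> mv_sup M x y" "y \<preceq> mv_sup M x y"
  using assms by (simp_all add: mv_sup_def le_plus le_plus_diff)

lemma sup_least:
  assumes "x \<in> carrier M" "y \<in> carrier M" "z \<in> carrier M" "x \<preceq> z" "y \<preceq> z"
  shows "mv_sup M x y \<preceq> z"
proof -
  have "mv_sup M x y \<preceq> x \<oplus> (z \<ominus> x)"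
    unfolding mv_sup_def using assms by (simp add: plus_mono diff_mono)
  then show ?thesis using assms by (simp add: le_imp_plus_diff)
qed

lemma inf_lower:
  assumes "x \<in> carrier M" "y \<in> carrier M"
  shows "mv_inf M x y \<preceq> x" "mv_inf M x y \<preceq> y"
  using sup_upper[of "neg x" "neg y"] assms neg_le_neg[of "mv_sup M (neg x) (neg y)" "neg x"]
    neg_le_neg[of "mv_sup M (neg x) (neg y)" "neg y"]
  by (simp_all add: mv_inf_def)

lemma inf_greatest:
  assumes "x \<in> carrier M" "y \<in> carrier M" "z \<in> carrier M" "z \<preceq> x" "z \<preceq> y"
  shows "z \<preceq> mv_inf M x y"
  using sup_least[of "neg x" "neg y" "neg z"] assms
    neg_le_neg[of "neg z" "mv_sup M (neg x) (neg y)"]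
  by (simp add: mv_inf_def neg_le_neg)

text \<open>Cancellation of \<open>m\<close> is sound because \<open>z \<preceq> neg m\<close> keeps
  the sum from being truncated at one. In detail, \<open>neg z\<close> is
  \<open>m \<oplus> (neg z \<ominus> m)\<close>, and the second summand is
  \<open>neg (z \<oplus> m)\<close>, that is, \<open>neg m\<close>.\<close>

lemma plus_eq_imp_zero:
  assumes "m \<in> carrier M" "z \<in> carrier M" "m \<oplus> z = m" "z \<preceq> neg m"
  shows "z = \<^bold>0"
proof -
  have "m \<preceq> neg z" using assms neg_le_neg[of "neg m" z] by simp
  then have "m \<oplus> (neg z \<ominus> m) = neg z" using assms by (simp add: le_imp_plus_diff)
  moreover have "neg z \<ominus> m = neg m" using assms by (simp add: mv_diff_def plus_comm)
  ultimately have "neg z = \<^bold>1" using assms neg_plus_self[of m] by (simp add: plus_comm)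
  then show ?thesis using assms by (metis neg_neg neg_one)
qed

text \<open>Let \<open>m\<close> be the meet of \<open>x\<close> and \<open>y\<close>. If
  \<open>z\<close> is below both differences, then \<open>m \<oplus> z\<close> is still below
  \<open>x\<close> and \<open>y\<close>, hence equals \<open>m\<close>, and \<open>m\<close>
  cancels.\<close>

lemma disjoint_diffs:
  assumes x: "x \<in> carrier M" and y: "y \<in> carrier M"
  shows "disjoint_elts M (x \<ominus> y) (y \<ominus> x)"
  unfolding disjoint_elts_def
proof (intro ballI impI)
  fix z assume z: "z \<in> carrier M" "z \<preceq> x \<ominus> y" "z \<preceq> y \<ominus> x"
  define m where "m = mv_inf M x y"
  have m: "m \<in> carrier M" "m \<preceq> x" "m \<preceq> y" using x y by (auto simp: m_def inf_lower)
  have below: "m \<oplus> z \<preceq> a"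
    if "a \<in> carrier M" "b \<in> carrier M" "z \<preceq> a \<ominus> b" "m \<preceq> a" "m \<preceq> b" for a b
  proof -
    have "z \<preceq> a \<ominus> m"
      using le_trans[OF _ _ _ that(3) diff_antimono[of m b a]] that m z by simp
    then have "m \<oplus> z \<preceq> m \<oplus> (a \<ominus> m)" using that m z by (simp add: plus_mono)
    then show ?thesis using that m by (simp add: le_imp_plus_diff)
  qed
  have "m \<oplus> z \<preceq> m"
    using below[of x y] below[of y x] x y z m
    by (subst (2) m_def) (simp add: inf_greatest)
  then have "m \<oplus> z = m" using m z by (simp add: le_antisym le_plus)
  \<comment> \<open>This bound makes the cancellation legitimate:
    \<open>m \<preceq> y \<preceq> neg x \<oplus> y\<close>, and the last term is
    \<open>neg (x \<ominus> y)\<close>.\<close>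
  moreover have "x \<ominus> y \<preceq> neg m"
  proof -
    have "m \<preceq> neg x \<oplus> y"
      using le_trans[OF _ _ _ m(3) le_plus2[of y "neg x"]] m x y by simp
    then show ?thesis using m x y by (simp add: mv_diff_def neg_le_neg)
  qed
  then have "z \<preceq> neg m" using le_trans[OF _ _ _ z(2), of "neg m"] x y z m by simp
  ultimately show "z = \<^bold>0" using plus_eq_imp_zero m z by blast
qed

lemma disjoint_elts_sym: "disjoint_elts M u v \<Longrightarrow> disjoint_elts M v u"
  by (auto simp: disjoint_elts_def)

subsection \<open>Ideals and prime separation\<close>

lemma mv_ideal_polar:
  assumes "X \<subseteq> carrier M"
  shows "mv_ideal M (polar M X)"
proof -
  have zero: "\<^bold>0 \<in> polar M X"
    by (auto simp: polar_def disjoint_elts_def intro: le_antisym zero_le)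
  have plus: "u \<oplus> v \<in> polar M X" if "u \<in> polar M X" "v \<in> polar M X" for u v
    unfolding polar_def
  proof (intro CollectI conjI ballI)
    have uv: "u \<in> carrier M" "v \<in> carrier M" using that by (auto simp: polar_def)
    then show "u \<oplus> v \<in> carrier M" by simp
    fix x assume "x \<in> X"
    then have x: "x \<in> carrier M" "disjoint_elts M u x" "disjoint_elts M v x"
      using assms that by (auto simp: polar_def)
    show "disjoint_elts M (u \<oplus> v) x"
      unfolding disjoint_elts_def
    proof (intro ballI impI)
      fix z assume z: "z \<in> carrier M" "z \<preceq> u \<oplus> v" "z \<preceq> x"
      \<comment> \<open>Residuation removes \<open>u\<close> from the bound on \<open>z\<close>.
        What remains is below \<open>v\<close> and below \<open>x\<close>, so it vanishes, and
        \<open>z\<close> is already below \<open>u\<close>.\<close>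
      have "z \<ominus> u \<preceq> v" "z \<ominus> u \<preceq> x"
        using z uv x le_trans[OF _ _ _ diff_le[of z u] z(3)] by (simp_all add: diff_le_iff)
      then have "z \<ominus> u = \<^bold>0" using x(3) z uv by (simp add: disjoint_elts_def)
      then have "z \<preceq> u" using z uv by (simp add: diff_eq_zero_iff)
      then show "z = \<^bold>0" using x(2) z by (simp add: disjoint_elts_def)
    qed
  qed
  have down: "v \<in> polar M X" if "u \<in> polar M X" "v \<in> carrier M" "v \<preceq> u" for u v
    using that le_trans[of _ v u] by (fastforce simp: polar_def disjoint_elts_def)
  show ?thesis
    unfolding mv_ideal_def using zero plus down by (auto simp: polar_def)
qed

lemma mv_ideal_sum:
  assumes I: "mv_ideal M I" and J: "mv_ideal M J"
  shows "mv_ideal M (ideal_sum M I J)"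
proof -
  note [simp] = mv_idealD(1-3)[OF I] mv_idealD(1-3)[OF J]
  have zero: "\<^bold>0 \<in> ideal_sum M I J"
    unfolding ideal_sum_def by (auto intro!: bexI[of _ "\<^bold>0"] simp: le_refl)
  have plus: "x \<oplus> y \<in> ideal_sum M I J" if xy: "x \<in> ideal_sum M I J" "y \<in> ideal_sum M I J" for x y
  proof -
    obtain u v u' v' where *: "x \<in> carrier M" "u \<in> I" "v \<in> J" "x \<preceq> u \<oplus> v"
      "y \<in> carrier M" "u' \<in> I" "v' \<in> J" "y \<preceq> u' \<oplus> v'"
      using xy by (auto simp: ideal_sum_def)
    have "x \<oplus> y \<preceq> (u \<oplus> v) \<oplus> (u' \<oplus> v')" using * by (simp add: plus_mono2)
    also have "\<dots> = (u \<oplus> u') \<oplus> (v \<oplus> v')" using * by (simp add: plus_assoc plus_lcomm)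
    finally show ?thesis
      unfolding ideal_sum_def using * mv_idealD(3)[OF I *(2,6)] mv_idealD(3)[OF J *(3,7)] plus_closed
      by blast
  qed
  have down: "y \<in> ideal_sum M I J" if "x \<in> ideal_sum M I J" "y \<in> carrier M" "y \<preceq> x" for x y
  proof -
    obtain u v where "x \<in> carrier M" "u \<in> I" "v \<in> J" "x \<preceq> u \<oplus> v"
      using \<open>x \<in> ideal_sum M I J\<close> by (auto simp: ideal_sum_def)
    then show ?thesis
      unfolding ideal_sum_def using that le_trans[of y x "u \<oplus> v"] by auto
  qed
  show ?thesis
    unfolding mv_ideal_def using zero plus down by (auto simp: ideal_sum_def)
qed

lemma ideal_sum_upper:
  assumes I: "mv_ideal M I" and J: "mv_ideal M J"
  shows "I \<subseteq> ideal_sum M I J" "J \<subseteq> ideal_sum M I J"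
proof -
  note [simp] = mv_idealD(1,2)[OF I] mv_idealD(1,2)[OF J]
  have "x \<preceq> x \<oplus> \<^bold>0" if "x \<in> I" for x using that by (simp add: le_refl)
  then show "I \<subseteq> ideal_sum M I J"
    unfolding ideal_sum_def using mv_idealD(1)[OF I] mv_idealD(2)[OF J] by blast
  have "x \<preceq> \<^bold>0 \<oplus> x" if "x \<in> J" for x using that by (simp add: le_refl)
  then show "J \<subseteq> ideal_sum M I J"
    unfolding ideal_sum_def using mv_idealD(1)[OF J] mv_idealD(2)[OF I] by blast
qed

text \<open>Zorn's lemma gives an ideal maximal among those missing \<open>F\<close>. If it
  contained neither of two opposite differences, two enlargements would both meet \<open>F\<close>;
  directedness gives one element of \<open>F\<close> below both meeting points, and orthogonality
  forces it into the ideal.\<close>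

lemma prime_ideal_disjoint_from:
  assumes F: "F \<subseteq> carrier M" "F \<noteq> {}" "\<^bold>0 \<notin> F"
    and dir: "\<And>c d. c \<in> F \<Longrightarrow> d \<in> F \<Longrightarrow> \<exists>e\<in>F. e \<preceq> c \<and> e \<preceq> d"
  obtains P where "mv_prime M P" "P \<inter> F = {}"
proof -
  define Z where "Z = {I. mv_ideal M I \<and> I \<inter> F = {}}"
  have "{\<^bold>0} \<in> Z"
    using F(3) by (auto simp: Z_def mv_ideal_def intro: le_antisym zero_le)
  then have "Z \<noteq> {}" by blast
  moreover have "\<Union>C \<in> Z" if C: "C \<noteq> {}" "subset.chain Z C" for C
  proof -
    have ideal: "mv_ideal M I" "I \<inter> F = {}" if "I \<in> C" for I
      using C(2) that by (auto simp: Z_def subset_chain_def)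
    have "x \<oplus> y \<in> \<Union>C" if xy: "x \<in> I" "I \<in> C" "y \<in> J" "J \<in> C" for x y I J
    proof -
      have "I \<subseteq> J \<or> J \<subseteq> I" using C(2) xy by (auto simp: subset_chain_def)
      then obtain K where "K \<in> C" "x \<in> K" "y \<in> K" using xy by blast
      then show ?thesis using mv_idealD(3)[OF ideal(1)] by blast
    qed
    moreover have "\<Union>C \<subseteq> carrier M" using mv_idealD(1)[OF ideal(1)] by blast
    moreover have "\<^bold>0 \<in> \<Union>C" using mv_idealD(2)[OF ideal(1)] C(1) by blast
    moreover have "y \<in> \<Union>C" if "x \<in> I" "I \<in> C" "y \<in> carrier M" "y \<preceq> x" for x y I
      using mv_idealD(4)[OF ideal(1)[OF that(2)] that(1,3,4)] that(2) by blast
    ultimately have "mv_ideal M (\<Union>C)" unfolding mv_ideal_def by simp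
    then show ?thesis using ideal(2) by (auto simp: Z_def)
  qed
  ultimately obtain P where P: "P \<in> Z" and max: "\<And>X. X \<in> Z \<Longrightarrow> P \<subseteq> X \<Longrightarrow> X = P"
    using subset_Zorn_nonempty[of Z] by blast
  have ideal: "mv_ideal M P" and disj: "P \<inter> F = {}" using P by (auto simp: Z_def)
  \<comment> \<open>Maximality of \<open>P\<close> is used here: an ideal sum strictly above
    \<open>P\<close> cannot miss \<open>F\<close>.\<close>
  have meets: "\<exists>c\<in>F. \<exists>p\<in>P. \<exists>s\<in>U. c \<preceq> p \<oplus> s"
    if U: "mv_ideal M U" "u \<in> U" "u \<notin> P" for u U
  proof (rule ccontr)
    assume "\<not> ?thesis"
    then have "ideal_sum M P U \<inter> F = {}" by (auto simp: ideal_sum_def)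
    then have "ideal_sum M P U \<in> Z" using mv_ideal_sum[OF ideal U(1)] by (simp add: Z_def)
    then show False using max ideal_sum_upper[OF ideal U(1)] U by blast
  qed
  have "x \<ominus> y \<in> P \<or> y \<ominus> x \<in> P" if xy: "x \<in> carrier M" "y \<in> carrier M" for x y
  proof (rule ccontr)
    assume not: "\<not> ?thesis"
    txt \<open>The ideals generated by \<open>P\<close> and one of the two differences are replaced by \<open>P + U\<close> and
      \<open>P + V\<close> for orthogonal polars \<open>U\<close>, \<open>V\<close>, which avoids multiples of the generator.\<close>
    define U where "U = polar M {y \<ominus> x}"
    define V where "V = polar M U"
    have "x \<ominus> y \<in> U" using xy by (simp add: U_def polar_def disjoint_diffs)
    have "y \<ominus> x \<in> V"
      using xy by (auto simp: V_def U_def polar_def intro: disjoint_elts_sym)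
    have "mv_ideal M U" unfolding U_def using xy by (intro mv_ideal_polar) simp
    then have "mv_ideal M V" unfolding V_def by (intro mv_ideal_polar) (auto dest: mv_idealD(1))
    obtain c p s where c: "c \<in> F" "p \<in> P" "s \<in> U" "c \<preceq> p \<oplus> s"
      using meets[OF \<open>mv_ideal M U\<close> \<open>x \<ominus> y \<in> U\<close>] not by blast
    obtain d q t where d: "d \<in> F" "q \<in> P" "t \<in> V" "d \<preceq> q \<oplus> t"
      using meets[OF \<open>mv_ideal M V\<close> \<open>y \<ominus> x \<in> V\<close>] not by blast
    obtain e where e: "e \<in> F" "e \<preceq> c" "e \<preceq> d" using dir c d by blast
    have [simp]: "c \<in> carrier M" "d \<in> carrier M" "e \<in> carrier M" using F(1) c d e by auto
    have [simp]: "p \<in> carrier M" "q \<in> carrier M" using mv_idealD(1)[OF ideal] c d by auto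
    have [simp]: "s \<in> carrier M" "t \<in> carrier M"
      using c d \<open>mv_ideal M U\<close> \<open>mv_ideal M V\<close> by (auto dest: mv_idealD(1))
    \<comment> \<open>A common element of \<open>P\<close> for both bounds on \<open>e\<close>; then
      \<open>e \<ominus> ?r\<close> is below the orthogonal elements \<open>s\<close> and
      \<open>t\<close>.\<close>
    let ?r = "p \<oplus> q"
    have "e \<preceq> ?r \<oplus> s"
    proof (rule le_trans[OF _ _ _ e(2)], simp_all)
      show "c \<preceq> p \<oplus> q \<oplus> s"
        by (rule le_trans[OF _ _ _ c(4)]) (simp_all add: plus_mono2 le_refl le_plus)
    qed
    then have "e \<ominus> ?r \<preceq> s" by (simp add: diff_le_iff)
    have "e \<preceq> ?r \<oplus> t"
    proof (rule le_trans[OF _ _ _ e(3)], simp_all)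
      show "d \<preceq> p \<oplus> q \<oplus> t"
        by (rule le_trans[OF _ _ _ d(4)]) (simp_all add: plus_mono2 le_refl le_plus2)
    qed
    then have "e \<ominus> ?r \<preceq> t" by (simp add: diff_le_iff)
    moreover have "disjoint_elts M t s" using c(3) d(3) by (simp add: V_def polar_def)
    ultimately have "e \<ominus> ?r = \<^bold>0"
      using \<open>e \<ominus> ?r \<preceq> s\<close> by (simp add: disjoint_elts_def)
    then have "e \<preceq> ?r" by (simp add: diff_eq_zero_iff)
    then have "e \<in> P" using mv_idealD(4)[OF ideal mv_idealD(3)[OF ideal c(2) d(2)]] by simp
    then show False using disj e by blast
  qed
  then have "mv_prime M P" using ideal by (simp add: mv_prime_def)
  then show thesis using disj that by blast
qed

subsection \<open>Quotients\<close>

lemma mv_cong_refl: "mv_ideal M I \<Longrightarrow> x \<in> carrier M \<Longrightarrow> mv_cong M I x x"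
  using diff_eq_zero_iff[of x x] by (simp add: mv_cong_def mv_idealD(2) le_refl)

lemma mv_cong_sym: "mv_cong M I x y \<Longrightarrow> mv_cong M I y x"
  by (simp add: mv_cong_def)

lemma mv_cong_trans:
  assumes I: "mv_ideal M I" and "x \<in> carrier M" "y \<in> carrier M" "z \<in> carrier M"
    and "mv_cong M I x y" "mv_cong M I y z"
  shows "mv_cong M I x z"
proof -
  have *: "a \<ominus> c \<in> I"
    if "a \<in> carrier M" "b \<in> carrier M" "c \<in> carrier M" "a \<ominus> b \<in> I" "b \<ominus> c \<in> I" for a b c
    using mv_idealD(4)[OF I mv_idealD(3)[OF I that(4,5)] _ diff_triangle] that by simp
  show ?thesis using assms *[of x y z] *[of z y x] by (simp add: mv_cong_def)
qed

lemma mv_cong_plus: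
  assumes I: "mv_ideal M I" and "x \<in> carrier M" "y \<in> carrier M" "u \<in> carrier M" "v \<in> carrier M"
    and "mv_cong M I x y" "mv_cong M I u v"
  shows "mv_cong M I (x \<oplus> u) (y \<oplus> v)"
proof -
  have *: "(a \<oplus> c) \<ominus> (b \<oplus> d) \<in> I"
    if "a \<in> carrier M" "b \<in> carrier M" "c \<in> carrier M" "d \<in> carrier M" "a \<ominus> b \<in> I" "c \<ominus> d \<in> I"
    for a b c d
    using mv_idealD(4)[OF I mv_idealD(3)[OF I that(5,6)] _ diff_plus_le] that by simp
  show ?thesis using assms *[of x y u v] *[of y x v u] by (simp add: mv_cong_def)
qed

lemma mv_cong_neg:
  assumes "x \<in> carrier M" "y \<in> carrier M" "mv_cong M I x y"
  shows "mv_cong M I (neg x) (neg y)"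
  using assms by (simp add: mv_cong_def neg_diff_neg)

lemma mv_rep:
  assumes "mv_ideal M I" "x \<in> carrier M"
  shows "mv_rep M I x \<in> carrier M" "mv_cong M I x (mv_rep M I x)"
  using someI[of "\<lambda>y. y \<in> carrier M \<and> mv_cong M I x y" x] assms
  by (auto simp: mv_rep_def mv_cong_refl)

lemma mv_rep_eq_iff:
  assumes I: "mv_ideal M I" and xy: "x \<in> carrier M" "y \<in> carrier M"
  shows "mv_rep M I x = mv_rep M I y \<longleftrightarrow> mv_cong M I x y"
proof
  assume "mv_rep M I x = mv_rep M I y"
  then have "mv_cong M I (mv_rep M I x) y"
    using mv_rep(2)[OF I xy(2)] by (simp add: mv_cong_sym)
  then show "mv_cong M I x y"
    using mv_cong_trans[OF I xy(1) _ xy(2)] mv_rep[OF I xy(1)] by blast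
next
  assume xy': "mv_cong M I x y"
  \<comment> \<open>The two choice predicates coincide, so \<open>SOME\<close> selects the same
    element.\<close>
  have "z \<in> carrier M \<and> mv_cong M I x z \<longleftrightarrow> z \<in> carrier M \<and> mv_cong M I y z" for z
    using mv_cong_trans[OF I xy _ xy'] mv_cong_trans[OF I xy(2,1) _ mv_cong_sym[OF xy']] by blast
  then show "mv_rep M I x = mv_rep M I y" by (simp add: mv_rep_def)
qed

lemma mv_rep_plus_rep:
  assumes I: "mv_ideal M I" and xy: "x \<in> carrier M" "y \<in> carrier M"
  shows "mv_rep M I (mv_rep M I x \<oplus> y) = mv_rep M I (x \<oplus> y)"
    and "mv_rep M I (x \<oplus> mv_rep M I y) = mv_rep M I (x \<oplus> y)"
  using xy mv_rep[OF I] mv_cong_sym mv_cong_refl[OF I]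
  by (simp_all add: mv_rep_eq_iff[OF I] mv_cong_plus[OF I])

lemma mv_rep_neg_rep:
  assumes I: "mv_ideal M I" and "x \<in> carrier M"
  shows "mv_rep M I (neg (mv_rep M I x)) = mv_rep M I (neg x)"
  using assms mv_rep[OF I] mv_cong_sym by (simp add: mv_rep_eq_iff[OF I] mv_cong_neg)

lemma mv_quotient:
  assumes I: "mv_ideal M I"
  shows "mv_algebra (mv_quotient M I)" "mv_rep M I \<in> mv_hom M (mv_quotient M I)"
proof -
  note [simp] = mv_rep_plus_rep[OF I] mv_rep_neg_rep[OF I] mv_rep(1)[OF I]
  have [simp]: "mv_rep M I (mv_rep M I x) = mv_rep M I x" if "x \<in> carrier M" for x
    using mv_rep(2)[OF I that] that by (simp add: mv_rep_eq_iff[OF I] mv_cong_sym)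
  \<comment> \<open>Elements of the quotient are their own representatives, so each axiom reduces to
    the one in \<open>M\<close> under \<open>mv_rep\<close>.\<close>
  have carrier: "x \<in> carrier M \<and> mv_rep M I x = x" if "x \<in> carrier (mv_quotient M I)" for x
    using that by (auto simp: mv_quotient_def)
  show "mv_algebra (mv_quotient M I)"
    by (rule mv_algebraI; ((drule carrier)+)?; simp add: mv_quotient_def plus_assoc plus_comm plus_lcomm
        lukasiewicz)
  show "mv_rep M I \<in> mv_hom M (mv_quotient M I)"
    by (auto simp: mv_quotient_def mv_hom_def)
qed

text \<open>Comparability of classes amounts to \<open>neg x \<oplus> y\<close> being congruent to
  one. One of the two differences between these is zero and the other is
  \<open>x \<ominus> y\<close>, which is what primality speaks of.\<close>

lemma linearly_ordered_quotient:
  assumes P: "mv_prime M P"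
  shows "linearly_ordered (mv_quotient M P)"
proof -
  have I: "mv_ideal M P" using P by (simp add: mv_prime_def)
  have le: "mv_le (mv_quotient M P) (mv_rep M P x) (mv_rep M P y)"
    if xy: "x \<in> carrier M" "y \<in> carrier M" "x \<ominus> y \<in> P" for x y
  proof -
    have "\<^bold>1 \<ominus> (neg x \<oplus> y) = x \<ominus> y" "(neg x \<oplus> y) \<ominus> \<^bold>1 = \<^bold>0"
      using xy by (simp_all add: mv_diff_def)
    then have "mv_cong M P (neg x \<oplus> y) \<^bold>1"
      using xy by (simp add: mv_cong_def mv_idealD(2)[OF I])
    then show ?thesis
      using xy by (simp add: mv_le_def mv_quotient_def mv_rep(1)[OF I] mv_rep_plus_rep[OF I]
          mv_rep_neg_rep[OF I] mv_rep_eq_iff[OF I])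
  qed
  show ?thesis
    unfolding linearly_ordered_def
  proof (intro ballI)
    fix u v assume "u \<in> carrier (mv_quotient M P)" "v \<in> carrier (mv_quotient M P)"
    then obtain x y where "x \<in> carrier M" "y \<in> carrier M" "u = mv_rep M P x" "v = mv_rep M P y"
      by (auto simp: mv_quotient_def)
    then show "mv_le (mv_quotient M P) u v \<or> mv_le (mv_quotient M P) v u"
      using P le unfolding mv_prime_def by blast
  qed
qed

end

subsection \<open>Epimorphisms\<close>

lemma mv_homD:
  assumes "f \<in> mv_hom M N"
  shows "x \<in> carrier M \<Longrightarrow> f x \<in> carrier N"
    "x \<in> carrier M \<Longrightarrow> y \<in> carrier M \<Longrightarrow> f (mv_plus M x y) = mv_plus N (f x) (f y)"
    "x \<in> carrier M \<Longrightarrow> f (mv_neg M x) = mv_neg N (f x)"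
    "f (mv_zero M) = mv_zero N" "f (mv_one M) = mv_one N"
  using assms by (auto simp: mv_hom_def)

lemma mv_hom_terms:
  assumes M: "mv_algebra M" and f: "f \<in> mv_hom M N" and xy: "x \<in> carrier M" "y \<in> carrier M"
  shows "f (mv_diff M x y) = mv_diff N (f x) (f y)"
    "f (mv_sup M x y) = mv_sup N (f x) (f y)"
    "f (mv_inf M x y) = mv_inf N (f x) (f y)"
    "mv_le M x y \<Longrightarrow> mv_le N (f x) (f y)"
proof -
  interpret mv_algebra M by (fact M)
  note [simp] = mv_homD[OF f]
  have diff: "f (mv_diff M u v) = mv_diff N (f u) (f v)"
    if "u \<in> carrier M" "v \<in> carrier M" for u v
    using that by (simp add: mv_diff_def)
  have sup: "f (mv_sup M u v) = mv_sup N (f u) (f v)"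
    if "u \<in> carrier M" "v \<in> carrier M" for u v
    using that by (simp add: mv_sup_def diff)
  show "f (mv_diff M x y) = mv_diff N (f x) (f y)" "f (mv_sup M x y) = mv_sup N (f x) (f y)"
    "f (mv_inf M x y) = mv_inf N (f x) (f y)"
    using xy by (simp_all add: diff sup mv_inf_def)
  show "mv_le N (f x) (f y)" if "mv_le M x y"
    using arg_cong[OF that[unfolded mv_le_def], of f] xy by (simp add: mv_le_def)
qed

lemma mv_ideal_preimage:
  assumes M: "mv_algebra M" and f: "f \<in> mv_hom M N" and P: "mv_ideal N P"
  shows "mv_ideal M {m \<in> carrier M. f m \<in> P}"
proof -
  interpret mv_algebra M by (fact M)
  show ?thesis
    unfolding mv_ideal_def
    by (auto simp: mv_homD[OF f] mv_idealD(2,3)[OF P] intro: mv_idealD(4)[OF P] mv_hom_terms(4)[OF M f])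
qed

text \<open>Test maps on \<open>N'\<close> are pulled back along \<open>g\<close>, cancelled on
  \<open>N\<close>, and compared using surjectivity. It is meant for projections onto
  quotients.\<close>

lemma mv_epi_surj_comp:
  fixes N :: "'b mv_algebra" and N' :: "'b mv_algebra"
  assumes f: "mv_epi M N f" and g: "g \<in> mv_hom N N'" "g ` carrier N = carrier N'"
  shows "mv_epi M N' (\<lambda>x. g (f x))"
  unfolding mv_epi_def
proof (intro conjI allI impI ballI)
  show "(\<lambda>x. g (f x)) \<in> mv_hom M N'" using f g(1) by (auto simp: mv_epi_def intro: mv_hom_comp)
next
  fix P :: "('b + nat) mv_algebra" and \<alpha> \<beta> y
  assume P: "mv_algebra P" "\<alpha> \<in> mv_hom N' P" "\<beta> \<in> mv_hom N' P"
    and eq: "\<forall>x\<in>carrier M. \<alpha> (g (f x)) = \<beta> (g (f x))" and "y \<in> carrier N'"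
  then obtain x where "x \<in> carrier N" "y = g x" using g(2) by auto
  then show "\<alpha> y = \<beta> y"
    using mv_epi_cancel[OF f P(1) mv_hom_comp[OF g(1) P(2)] mv_hom_comp[OF g(1) P(3)]] eq by simp
qed

text \<open>The map is \<open>N \<rightarrow> N/P \<cong> M/f\<^sup>-\<^sup>1 P \<rightarrow> M/J\<close>.\<close>

lemma factor_hom:
  assumes M: "mv_algebra M" and N: "mv_algebra N" and f: "f \<in> mv_hom M N"
    and P: "mv_ideal N P" and onto: "\<And>a. a \<in> carrier N \<Longrightarrow> \<exists>m\<in>carrier M. mv_cong N P (f m) a"
    and J: "mv_ideal M J" "{m \<in> carrier M. f m \<in> P} \<subseteq> J"
  obtains \<alpha> where "\<alpha> \<in> mv_hom N (mv_quotient M J)"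
    "\<And>m a. m \<in> carrier M \<Longrightarrow> a \<in> carrier N \<Longrightarrow> mv_cong N P (f m) a \<Longrightarrow> \<alpha> a = mv_rep M J m"
proof -
  interpret M: mv_algebra M by (fact M)
  interpret N: mv_algebra N by (fact N)
  note [simp] = mv_homD[OF f]
  define s where "s a = (SOME m. m \<in> carrier M \<and> mv_cong N P (f m) a)" for a
  define \<alpha> where "\<alpha> a = mv_rep M J (s a)" for a
  have s: "s a \<in> carrier M" "mv_cong N P (f (s a)) a" if "a \<in> carrier N" for a
    using someI_ex[of "\<lambda>m. m \<in> carrier M \<and> mv_cong N P (f m) a"] onto[OF that]
    by (auto simp: s_def)
  \<comment> \<open>Independence of the chosen lift: two lifts of \<open>a\<close> have differences
    in the preimage of \<open>P\<close>, hence in \<open>J\<close>. The homomorphism laws follow,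
    since \<open>s a\<close> and \<open>s b\<close> add up to some lift of the sum, though perhaps
    not the chosen one.\<close>
  have eq: "\<alpha> a = mv_rep M J m"
    if m: "m \<in> carrier M" "a \<in> carrier N" "mv_cong N P (f m) a" for m a
  proof -
    have "mv_cong N P (f (s a)) (f m)"
      using N.mv_cong_trans[OF P _ _ _ s(2) N.mv_cong_sym] m s by simp
    then have "mv_cong M J (s a) m"
      using J(2) s m by (auto simp: mv_cong_def mv_hom_terms(1)[OF M f, symmetric] subset_iff
          simp del: mv_homD[OF f])
    then show ?thesis using M.mv_rep_eq_iff[OF J(1)] s m by (simp add: \<alpha>_def)
  qed
  have "\<alpha> \<in> mv_hom N (mv_quotient M J)"
    unfolding mv_hom_def
  proof (intro CollectI conjI Pi_I ballI)
    show "\<alpha> a \<in> carrier (mv_quotient M J)" if "a \<in> carrier N" for a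
      using s that by (simp add: \<alpha>_def mv_quotient_def)
    show "\<alpha> (mv_plus N a b) = mv_plus (mv_quotient M J) (\<alpha> a) (\<alpha> b)"
      if "a \<in> carrier N" "b \<in> carrier N" for a b
    proof -
      have "\<alpha> (mv_plus N a b) = mv_rep M J (mv_plus M (s a) (s b))"
        using s that by (intro eq) (simp_all add: N.mv_cong_plus[OF P])
      then show ?thesis
        using s that mv_homD(2)[OF M.mv_quotient(2)[OF J(1)]] by (simp add: \<alpha>_def)
    qed
    show "\<alpha> (mv_neg N a) = mv_neg (mv_quotient M J) (\<alpha> a)" if "a \<in> carrier N" for a
    proof -
      have "\<alpha> (mv_neg N a) = mv_rep M J (mv_neg M (s a))"
        using s that by (intro eq) (simp_all add: N.mv_cong_neg)
      then show ?thesis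
        using s that mv_homD(3)[OF M.mv_quotient(2)[OF J(1)]] by (simp add: \<alpha>_def)
    qed
    show "\<alpha> (mv_zero N) = mv_zero (mv_quotient M J)"
      using eq[of "mv_zero M" "mv_zero N"] N.mv_cong_refl[OF P] by (simp add: mv_quotient_def)
    show "\<alpha> (mv_one N) = mv_one (mv_quotient M J)"
      using eq[of "mv_one M" "mv_one N"] N.mv_cong_refl[OF P] by (simp add: mv_quotient_def)
  qed
  then show thesis using that eq by blast
qed

lemma epi_interpolation:
  assumes M: "mv_algebra M" and N: "mv_algebra N" and f: "mv_epi M N f"
    and P: "mv_ideal N P" and Q: "mv_ideal N Q"
    and ontoP: "\<And>a. a \<in> carrier N \<Longrightarrow> \<exists>m\<in>carrier M. mv_cong N P (f m) a"
    and ontoQ: "\<And>a. a \<in> carrier N \<Longrightarrow> \<exists>m\<in>carrier M. mv_cong N Q (f m) a"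
    and a: "a \<in> carrier N"
  obtains m where "m \<in> carrier M" "mv_diff N (f m) a \<in> P" "mv_diff N a (f m) \<in> Q"
proof -
  interpret M: mv_algebra M by (fact M)
  interpret N: mv_algebra N by (fact N)
  have hom: "f \<in> mv_hom M N" using f by (simp add: mv_epi_def)
  note [simp] = mv_homD[OF hom]
  let ?p = "{m \<in> carrier M. f m \<in> P}" and ?q = "{m \<in> carrier M. f m \<in> Q}"
  define J where "J = ideal_sum M ?p ?q"
  have p: "mv_ideal M ?p" and q: "mv_ideal M ?q"
    using mv_ideal_preimage[OF M hom] P Q by auto
  have J: "mv_ideal M J" "?p \<subseteq> J" "?q \<subseteq> J"
    unfolding J_def using M.mv_ideal_sum[OF p q] M.ideal_sum_upper[OF p q] by auto
  obtain \<alpha> where \<alpha>: "\<alpha> \<in> mv_hom N (mv_quotient M J)"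
    "\<And>m a. m \<in> carrier M \<Longrightarrow> a \<in> carrier N \<Longrightarrow> mv_cong N P (f m) a \<Longrightarrow> \<alpha> a = mv_rep M J m"
    using factor_hom[OF M N hom P ontoP J(1,2)] by blast
  obtain \<beta> where \<beta>: "\<beta> \<in> mv_hom N (mv_quotient M J)"
    "\<And>m a. m \<in> carrier M \<Longrightarrow> a \<in> carrier N \<Longrightarrow> mv_cong N Q (f m) a \<Longrightarrow> \<beta> a = mv_rep M J m"
    using factor_hom[OF M N hom Q ontoQ J(1,3)] by blast
  \<comment> \<open>Both maps send \<open>f x\<close> to the class of \<open>x\<close>, so the
    epimorphism property identifies them.\<close>
  have "\<alpha> a = \<beta> a"
    by (rule mv_epi_cancel[OF f M.mv_quotient(1)[OF J(1)] \<alpha>(1) \<beta>(1) _ a])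
      (simp add: \<alpha>(2) \<beta>(2) N.mv_cong_refl[OF P] N.mv_cong_refl[OF Q])
  obtain m where m: "m \<in> carrier M" "mv_cong N P (f m) a" using ontoP a by blast
  obtain n where n: "n \<in> carrier M" "mv_cong N Q (f n) a" using ontoQ a by blast
  have "mv_cong M J m n"
    using \<open>\<alpha> a = \<beta> a\<close> \<alpha>(2)[OF m(1) a m(2)] \<beta>(2)[OF n(1) a n(2)] m n
    by (simp add: M.mv_rep_eq_iff[OF J(1)])
  then have "mv_diff M n m \<in> J" by (simp add: mv_cong_def)
  then obtain u v where uv: "u \<in> carrier M" "f u \<in> P" "v \<in> carrier M" "f v \<in> Q"
    "mv_le M (mv_diff M n m) (mv_plus M u v)"
    by (auto simp: J_def ideal_sum_def)
  \<comment> \<open>Adding \<open>u\<close> changes \<open>m\<close> only modulo the preimage of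
    \<open>P\<close>, while it leaves \<open>n \<ominus> k\<close> below \<open>v\<close>, whose
    image is in \<open>Q\<close>.\<close>
  define k where "k = mv_plus M m u"
  have k: "k \<in> carrier M" using m uv by (simp add: k_def)
  have "mv_le M n (mv_plus M k v)"
    using uv m n by (simp add: k_def M.diff_le_iff M.plus_assoc)
  then have "mv_le M (mv_diff M n k) v" using k n uv by (simp add: M.diff_le_iff)
  then have "mv_le N (mv_diff N (f n) (f k)) (f v)"
    using mv_hom_terms(4)[OF M hom, of "mv_diff M n k" v] k n uv
    by (simp add: mv_hom_terms(1)[OF M hom])
  then have nk: "mv_diff N (f n) (f k) \<in> Q" using mv_idealD(4)[OF Q uv(4)] k n by simp
  have "mv_diff N a (f n) \<in> Q" using n by (simp add: mv_cong_def)
  then have "mv_plus N (mv_diff N a (f n)) (mv_diff N (f n) (f k)) \<in> Q"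
    using nk by (rule mv_idealD(3)[OF Q])
  then have 1: "mv_diff N a (f k) \<in> Q"
    using mv_idealD(4)[OF Q _ _ N.diff_triangle] a k n by simp
  have "mv_diff N (f m) a \<in> P" using m by (simp add: mv_cong_def)
  then have *: "mv_plus N (mv_diff N (f m) a) (f u) \<in> P" using uv by (simp add: mv_idealD(3)[OF P])
  have "mv_le N (mv_plus N (f m) (f u)) (mv_plus N (mv_plus N a (mv_diff N (f m) a)) (f u))"
    using m uv a by (simp add: N.plus_mono2 N.le_refl N.le_plus_diff)
  then have "mv_le N (mv_diff N (f k) a) (mv_plus N (mv_diff N (f m) a) (f u))"
    using m uv a by (simp add: k_def N.diff_le_iff N.plus_assoc)
  then have "mv_diff N (f k) a \<in> P" using mv_idealD(4)[OF P *] k a by simp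
  then show thesis using 1 k that by blast
qed

text \<open>Prime separation is used twice. First \<open>P\<close> is fixed and \<open>Q\<close>
  varies, which yields a genuine upper bound \<open>f m\<close> of \<open>a\<close> that is exact
  modulo \<open>P\<close>. Then \<open>P\<close> varies over the upper bounds of \<open>a\<close> in
  the image.\<close>

lemma epi_surj_if_surj_modulo_primes:
  assumes M: "mv_algebra M" and N: "mv_algebra N" and f: "mv_epi M N f"
    and onto: "\<And>P a. mv_prime N P \<Longrightarrow> a \<in> carrier N \<Longrightarrow> \<exists>m\<in>carrier M. mv_cong N P (f m) a"
  shows "f ` carrier M = carrier N"
proof
  interpret M: mv_algebra M by (fact M)
  interpret N: mv_algebra N by (fact N)
  have hom: "f \<in> mv_hom M N" using f by (simp add: mv_epi_def)
  note [simp] = mv_homD[OF hom] mv_hom_terms(2,3)[OF M hom]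
  show "f ` carrier M \<subseteq> carrier N" by auto
  show "carrier N \<subseteq> f ` carrier M"
  proof
    fix a assume a: "a \<in> carrier N"
    have above: "\<exists>m\<in>carrier M. mv_diff N (f m) a \<in> P \<and> mv_le N a (f m)" if P: "mv_prime N P" for P
    proof (rule ccontr)
      assume none: "\<not> ?thesis"
      have I: "mv_ideal N P" using P by (simp add: mv_prime_def)
      \<comment> \<open>The deficits below \<open>a\<close> of those images that do not exceed
        \<open>a\<close> modulo \<open>P\<close>. A zero deficit would be the desired upper
        bound.\<close>
      define F where "F = {mv_diff N a (f m) | m. m \<in> carrier M \<and> mv_diff N (f m) a \<in> P}"
      have "F \<subseteq> carrier N" using a by (auto simp: F_def)
      moreover have "F \<noteq> {}" using onto[OF P a] by (auto simp: F_def mv_cong_def)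
      moreover have "mv_zero N \<notin> F"
      proof
        assume "mv_zero N \<in> F"
        then obtain m where "m \<in> carrier M" "mv_diff N (f m) a \<in> P" "mv_diff N a (f m) = mv_zero N"
          by (auto simp: F_def)
        then show False using none a by (simp add: N.diff_eq_zero_iff)
      qed
      moreover have "\<exists>e\<in>F. mv_le N e c \<and> mv_le N e d" if cd: "c \<in> F" "d \<in> F" for c d
      proof -
        obtain m n where m: "m \<in> carrier M" "mv_diff N (f m) a \<in> P" "c = mv_diff N a (f m)"
          and n: "n \<in> carrier M" "mv_diff N (f n) a \<in> P" "d = mv_diff N a (f n)"
          using cd by (auto simp: F_def)
        \<comment> \<open>The join lowers the deficit, and its excess over \<open>a\<close> is at
          most the sum of the two excesses, so it stays in \<open>P\<close>.\<close>
        define k where "k = mv_sup M m n"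
        have k: "k \<in> carrier M" "f k = mv_sup N (f m) (f n)" using m n by (simp_all add: k_def)
        let ?i = "mv_plus N (mv_diff N (f m) a) (mv_diff N (f n) a)"
        have "mv_le N (f m) (mv_plus N a ?i)" "mv_le N (f n) (mv_plus N a ?i)"
          using m n a N.diff_le_iff[of "f m" a ?i] N.diff_le_iff[of "f n" a ?i]
          by (simp_all add: N.le_plus N.le_plus2)
        then have "mv_le N (mv_diff N (f k) a) ?i"
          using m n a k by (simp add: N.diff_le_iff N.sup_least)
        then have "mv_diff N (f k) a \<in> P"
          using mv_idealD(4)[OF I mv_idealD(3)[OF I m(2) n(2)]] m n k a by simp
        then have "mv_diff N a (f k) \<in> F" unfolding F_def using k(1) by blast
        then show ?thesis using m n a k by (auto simp: N.diff_antimono N.sup_upper intro!: bexI)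
      qed
      ultimately obtain Q where Q: "mv_prime N Q" "Q \<inter> F = {}"
        using N.prime_ideal_disjoint_from[of F] by metis
      have "mv_ideal N Q" using Q by (simp add: mv_prime_def)
      then obtain m where "m \<in> carrier M" "mv_diff N (f m) a \<in> P" "mv_diff N a (f m) \<in> Q"
        \<comment> \<open>Interpolation between \<open>P\<close> and \<open>Q\<close> produces a
          deficit lying in \<open>Q\<close>, against \<open>Q \<inter> F = {}\<close>.\<close>
        using epi_interpolation[OF M N f I _ onto[OF P] onto[OF Q(1)] a] by blast
      then show False using Q(2) by (auto simp: F_def)
    qed
    show "a \<in> f ` carrier M"
    proof (rule ccontr)
      assume none: "a \<notin> f ` carrier M"
      \<comment> \<open>Now the excesses of the upper bounds of \<open>a\<close> in the image, with
        one as a first such bound. Meets make the set down-directed, and a zero excess would give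
        \<open>f m = a\<close>.\<close>
      define F where "F = {mv_diff N (f m) a | m. m \<in> carrier M \<and> mv_le N a (f m)}"
      have "F \<subseteq> carrier N" using a by (auto simp: F_def)
      moreover have "F \<noteq> {}" using a N.le_one[OF a] by (auto simp: F_def intro!: exI[of _ "mv_one M"])
      moreover have "mv_zero N \<notin> F"
      proof
        assume "mv_zero N \<in> F"
        then obtain m where m: "m \<in> carrier M" "mv_le N a (f m)" "mv_diff N (f m) a = mv_zero N"
          by (auto simp: F_def)
        then have "f m = a" using a by (intro N.le_antisym) (simp_all add: N.diff_eq_zero_iff)
        then show False using none m by blast
      qed
      moreover have "\<exists>e\<in>F. mv_le N e c \<and> mv_le N e d" if cd: "c \<in> F" "d \<in> F" for c d
      proof -
        obtain m n where m: "m \<in> carrier M" "mv_le N a (f m)" "c = mv_diff N (f m) a"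
          and n: "n \<in> carrier M" "mv_le N a (f n)" "d = mv_diff N (f n) a"
          using cd by (auto simp: F_def)
        define k where "k = mv_inf M m n"
        have k: "k \<in> carrier M" "f k = mv_inf N (f m) (f n)" using m n by (simp_all add: k_def)
        have "mv_le N a (f k)" using m n a k by (simp add: N.inf_greatest)
        then have "mv_diff N (f k) a \<in> F" unfolding F_def using k(1) by blast
        then show ?thesis using m n a k by (auto simp: N.diff_mono N.inf_lower intro!: bexI)
      qed
      ultimately obtain P where P: "mv_prime N P" "P \<inter> F = {}"
        using N.prime_ideal_disjoint_from[of F] by metis
      \<comment> \<open>For this \<open>P\<close>, \<open>above\<close> supplies an upper bound
        whose excess lies both in \<open>P\<close> and in \<open>F\<close>.\<close>
      then show False using above[OF P(1)] by (auto simp: F_def)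
    qed
  qed
qed

theorem theorem3p15:
  fixes M :: "'a mv_algebra"
  assumes "mv_algebra M"
  shows "epicomplete TYPE('u) M \<longleftrightarrow>
    (\<forall>(A :: 'u mv_algebra) f. mv_algebra A \<longrightarrow> linearly_ordered A \<longrightarrow> mv_epi M A f \<longrightarrow>
       f ` carrier M = carrier A)"
proof
  assume linear: "\<forall>(A :: 'u mv_algebra) f. mv_algebra A \<longrightarrow> linearly_ordered A \<longrightarrow> mv_epi M A f \<longrightarrow>
       f ` carrier M = carrier A"
  show "epicomplete TYPE('u) M"
    unfolding epicomplete_def
  proof (intro allI impI)
    fix A :: "'u mv_algebra" and f
    assume A: "mv_algebra A" and f: "mv_epi M A f"
    interpret A: mv_algebra A by (fact A)
    show "f ` carrier M = carrier A"
    proof (rule epi_surj_if_surj_modulo_primes[OF assms A f])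
      fix P a assume P: "mv_prime A P" and a: "a \<in> carrier A"
      have I: "mv_ideal A P" using P by (simp add: mv_prime_def)
      \<comment> \<open>The quotient by a prime is a chain with carrier in the same type
        \<open>'u\<close>, so the hypothesis applies to the composite and gives surjectivity modulo
        \<open>P\<close>.\<close>
      have "mv_epi M (mv_quotient A P) (\<lambda>x. mv_rep A P (f x))"
        by (rule mv_epi_surj_comp[OF f A.mv_quotient(2)[OF I]]) (simp add: mv_quotient_def)
      then have "(\<lambda>x. mv_rep A P (f x)) ` carrier M = mv_rep A P ` carrier A"
        using linear A.mv_quotient(1)[OF I] A.linearly_ordered_quotient[OF P]
        by (simp add: mv_quotient_def)
      then obtain m where "m \<in> carrier M" "mv_rep A P (f m) = mv_rep A P a"
        using a by (metis (no_types, lifting) imageE imageI)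
      then show "\<exists>m\<in>carrier M. mv_cong A P (f m) a"
        using a mv_homD(1)[of f M A] f by (auto simp: A.mv_rep_eq_iff[OF I] mv_epi_def)
    qed
  qed
qed (simp add: epicomplete_def)

end
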